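(* Each of the following classes of structures is Borel complete (that is, the isomorphism relation on the space of structures in the class with underlying set $\mathbb{N}$ is Borel complete): the class of keis, the class of quandles, the class of racks, the class of left distributive algebras, and the class of algebras satisfying $\Sigma$.
   Context: Algebraic definitions. Consider the following axioms for a set $A$ with one binary operation $*$: (i) $a*(b*c)=(a*b)*(a*c)$ for all $a,b,c\in A$; (ii) for all $a,c\in A$ there is a unique $b\in A$ with $a*b=c$; (iii) $a*a=a$ for all $a\in A$; (iv) $a*(a*b)=b$ for all $a,b\in A$. A left distributive algebra is such a structure satisfying (i); a rack satisfies (i) and (ii); a quandle satisfies (i), (ii) and (iii); a kei satisfies (i), (ii), (iii) and (iv). An algebra satisfying $\Sigma$ is a set $A$ with two binary operations $*$ and $\circ$ such that for all $a,b,c\in A$: $a\circ(b\circ c)=(a\circ b)\circ c$; $(a\circ b)*c=a*(b*c)$; $a*(b\circ c)=(a*b)\circ(a*c)$; $(a*b)\circ a=a\circ b$. Spaces of structures. A first-order class of countable structures for a finite signature means the class of all structures with underlying set $\mathbb{N}$, with finitely many relations and operations, defined by first-order sentences in that signature. A $k$-ary relation on $\mathbb{N}$ is identified with a subset of $\mathbb{N}^k$, and a $k$-ary operation with its graph, a subset of $\mathbb{N}^{k+1}$. Hence each structure is identified with an element of $\mathcal{P}(X)=2^X$, where $X$ is the (countable) disjoint union of the relevant powers of $\mathbb{N}$, one for each relation and operation symbol. The set $2^X$ carries the product (Cantor space) topology, and the class is given the subspace topology. For example, the space of algebras $(\mathbb{N},* )$ has as a clopen subbase the sets $\{(\mathbb{N},*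 ) : \ell*m=n\}$ and $\{(\mathbb{N},* ) : \ell*m\neq n\}$ for $\ell,m,n\in\mathbb{N}$. Borel reducibility. A function between topological spaces is Borel if the preimage of every open set is Borel. Let $E$ and $F$ be equivalence relations on such spaces $X$ and $Y$ respectively. Then $E$ is Borel reducible to $F$, written $E\leq_B F$, if there is a Borel function $f\colon X\to Y$ such that for all $x,x'\in X$, $x\mathrel{E}x'$ if and only if $f(x)\mathrel{F}f(x')$. If $F$ is the isomorphism relation on a first-order class of countable structures for a finite signature, each with underlying set $\mathbb{N}$, then $F$ (and the class itself) is called Borel complete if the isomorphism relation of every other such class is Borel reducible to $F$. *)

theory Defs
  imports "HOL-Analysis.Analysis"
begin

section \<open>Borel maps and Borel reducibility\<close>

definition borel_map :: "'a topology \<Rightarrow> 'b topology \<Rightarrow> ('a \<Rightarrow> 'b) \<Rightarrow> bool" where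
  "borel_map X Y f \<longleftrightarrow>
     f \<in> topspace X \<rightarrow> topspace Y \<and>
     (\<forall>U. openin Y U \<longrightarrow>
        {x \<in> topspace X. f x \<in> U} \<in> sigma_sets (topspace X) {V. openin X V})"

definition borel_reducible ::
  "'a topology \<Rightarrow> ('a \<times> 'a) set \<Rightarrow> 'b topology \<Rightarrow> ('b \<times> 'b) set \<Rightarrow> bool" where
  "borel_reducible X E Y F \<longleftrightarrow>
     (\<exists>f. borel_map X Y f \<and>
        (\<forall>x \<in> topspace X. \<forall>x' \<in> topspace X. (x, x') \<in> E \<longleftrightarrow> (f x, f x') \<in> F))"

section \<open>Spaces of countable structures\<close>

text \<open>A finite signature is given by the lists of arities of its relation symbols and of its
  operation symbols; a symbol is referred to by its position in the respective list.
  Arity 0 is allowed, so constants are operation symbols of arity 0.\<close>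

record signature =
  rel_arities :: "nat list"
  op_arities :: "nat list"

datatype symb = RelSym nat | OpSym nat

text \<open>The disjoint union of the relevant powers of the natural numbers: an operation of arity
  \<open>k\<close> contributes the power \<open>k + 1\<close>, its graph being listed as arguments followed by value.\<close>

definition coords :: "signature \<Rightarrow> (symb \<times> nat list) set" where
  "coords L =
     {(RelSym i, xs) | i xs. i < length (rel_arities L) \<and> length xs = rel_arities L ! i} \<union>
     {(OpSym i, xs) | i xs. i < length (op_arities L) \<and> length xs = Suc (op_arities L ! i)}"

text \<open>The space \<open>2\<^sup>X\<close> for \<open>X = coords L\<close>. Its points are the characteristic functions of subsets
  of \<open>X\<close>, represented as functions that are \<open>undefined\<close> outside \<open>X\<close>.\<close>

type_synonym struct = "symb \<times> nat list \<Rightarrow> bool"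

definition cantor_topology :: "signature \<Rightarrow> struct topology" where
  "cantor_topology L = product_topology (\<lambda>_. discrete_topology UNIV) (coords L)"

definition structures :: "signature \<Rightarrow> struct set" where
  "structures L =
     {M \<in> topspace (cantor_topology L).
        \<forall>i < length (op_arities L). \<forall>xs. length xs = op_arities L ! i \<longrightarrow>
          (\<exists>!y. M (OpSym i, xs @ [y]))}"

definition rel_holds :: "struct \<Rightarrow> nat \<Rightarrow> nat list \<Rightarrow> bool" where
  "rel_holds M i xs \<longleftrightarrow> M (RelSym i, xs)"

definition op_val :: "struct \<Rightarrow> nat \<Rightarrow> nat list \<Rightarrow> nat" where
  "op_val M i xs = (THE y. M (OpSym i, xs @ [y]))"

definition class_space :: "signature \<Rightarrow> struct set \<Rightarrow> struct topology" where
  "class_space L C = subtopology (cantor_topology L) C"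

definition isomorphism :: "signature \<Rightarrow> (nat \<Rightarrow> nat) \<Rightarrow> struct \<Rightarrow> struct \<Rightarrow> bool" where
  "isomorphism L h M N \<longleftrightarrow>
     bij h \<and>
     (\<forall>i < length (rel_arities L). \<forall>xs. length xs = rel_arities L ! i \<longrightarrow>
        (rel_holds M i xs \<longleftrightarrow> rel_holds N i (map h xs))) \<and>
     (\<forall>i < length (op_arities L). \<forall>xs. length xs = op_arities L ! i \<longrightarrow>
        h (op_val M i xs) = op_val N i (map h xs))"

definition iso_rel :: "signature \<Rightarrow> struct set \<Rightarrow> (struct \<times> struct) set" where
  "iso_rel L C = {(M, N). M \<in> C \<and> N \<in> C \<and> (\<exists>h. isomorphism L h M N)}"

lemma equiv_iso_rel: "equiv C (iso_rel L C)"
proof (rule equivI)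
  show "iso_rel L C \<subseteq> C \<times> C"
    by (auto simp: iso_rel_def)
  have "isomorphism L id M M" for M
    by (simp add: isomorphism_def)
  then show "refl_on C (iso_rel L C)"
    unfolding refl_on_def iso_rel_def by blast
  have "isomorphism L (inv h) N M" if h: "isomorphism L h M N" for h M N
  proof -
    have b: "bij h" using h by (simp add: isomorphism_def)
    then have hi: "map h (map (inv h) xs) = xs" for xs
      by (simp add: bij_is_surj surj_f_inv_f o_def)
    have "rel_holds N i xs \<longleftrightarrow> rel_holds M i (map (inv h) xs)"
      if "i < length (rel_arities L)" "length xs = rel_arities L ! i" for i xs
      using h that hi[of xs] unfolding isomorphism_def by (metis length_map)
    moreover have "inv h (op_val N i xs) = op_val M i (map (inv h) xs)"
      if "i < length (op_arities L)" "length xs = op_arities L ! i" for i xs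
      using h that hi[of xs] b unfolding isomorphism_def
      by (metis length_map bij_inv_eq_iff)
    ultimately show ?thesis
      using b by (simp add: isomorphism_def bij_imp_bij_inv)
  qed
  then show "sym (iso_rel L C)"
    unfolding sym_def iso_rel_def by blast
  have "isomorphism L (k \<circ> h) M P" if "isomorphism L h M N" "isomorphism L k N P" for h k M N P
    using that by (auto simp: isomorphism_def bij_comp)
  then show "trans (iso_rel L C)"
    unfolding trans_def iso_rel_def by blast
qed

section \<open>First-order classes\<close>

datatype tm = Var nat | App nat "tm list"

datatype fm = Eq tm tm | Rel nat "tm list" | Neg fm | Conj fm fm | Forall nat fm

primrec wf_tm :: "signature \<Rightarrow> tm \<Rightarrow> bool" where
  "wf_tm L (Var n) \<longleftrightarrow> True"
| "wf_tm L (App i ts) \<longleftrightarrow>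
     i < length (op_arities L) \<and> length ts = op_arities L ! i \<and> list_all (wf_tm L) ts"

primrec wf_fm :: "signature \<Rightarrow> fm \<Rightarrow> bool" where
  "wf_fm L (Eq s t) \<longleftrightarrow> wf_tm L s \<and> wf_tm L t"
| "wf_fm L (Rel i ts) \<longleftrightarrow>
     i < length (rel_arities L) \<and> length ts = rel_arities L ! i \<and> list_all (wf_tm L) ts"
| "wf_fm L (Neg p) \<longleftrightarrow> wf_fm L p"
| "wf_fm L (Conj p q) \<longleftrightarrow> wf_fm L p \<and> wf_fm L q"
| "wf_fm L (Forall n p) \<longleftrightarrow> wf_fm L p"

primrec tm_vars :: "tm \<Rightarrow> nat set" where
  "tm_vars (Var n) = {n}"
| "tm_vars (App i ts) = \<Union> (set (map tm_vars ts))"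

primrec free_vars :: "fm \<Rightarrow> nat set" where
  "free_vars (Eq s t) = tm_vars s \<union> tm_vars t"
| "free_vars (Rel i ts) = \<Union> (set (map tm_vars ts))"
| "free_vars (Neg p) = free_vars p"
| "free_vars (Conj p q) = free_vars p \<union> free_vars q"
| "free_vars (Forall n p) = free_vars p - {n}"

definition sentence :: "signature \<Rightarrow> fm \<Rightarrow> bool" where
  "sentence L p \<longleftrightarrow> wf_fm L p \<and> free_vars p = {}"

primrec tm_val :: "struct \<Rightarrow> (nat \<Rightarrow> nat) \<Rightarrow> tm \<Rightarrow> nat" where
  "tm_val M v (Var n) = v n"
| "tm_val M v (App i ts) = op_val M i (map (tm_val M v) ts)"

primrec sat :: "struct \<Rightarrow> (nat \<Rightarrow> nat) \<Rightarrow> fm \<Rightarrow> bool" where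
  "sat M v (Eq s t) \<longleftrightarrow> tm_val M v s = tm_val M v t"
| "sat M v (Rel i ts) \<longleftrightarrow> rel_holds M i (map (tm_val M v) ts)"
| "sat M v (Neg p) \<longleftrightarrow> \<not> sat M v p"
| "sat M v (Conj p q) \<longleftrightarrow> sat M v p \<and> sat M v q"
| "sat M v (Forall n p) \<longleftrightarrow> (\<forall>a. sat M (v(n := a)) p)"

text \<open>The set of axioms may be infinite.\<close>

definition first_order_class :: "signature \<Rightarrow> struct set \<Rightarrow> bool" where
  "first_order_class L C \<longleftrightarrow>
     (\<exists>T. (\<forall>p \<in> T. sentence L p) \<and> C = {M \<in> structures L. \<forall>p \<in> T. \<forall>v. sat M v p})"

definition borel_complete :: "signature \<Rightarrow> struct set \<Rightarrow> bool" where
  "borel_complete L C \<longleftrightarrow>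
     first_order_class L C \<and>
     (\<forall>L' C'. first_order_class L' C' \<longrightarrow>
        borel_reducible (class_space L' C') (iso_rel L' C') (class_space L C) (iso_rel L C))"

section \<open>Racks, quandles, keis and related algebras\<close>

definition left_distributive :: "('a \<Rightarrow> 'a \<Rightarrow> 'a) \<Rightarrow> bool" where
  "left_distributive f \<longleftrightarrow> (\<forall>a b c. f a (f b c) = f (f a b) (f a c))"

definition is_rack :: "('a \<Rightarrow> 'a \<Rightarrow> 'a) \<Rightarrow> bool" where
  "is_rack f \<longleftrightarrow> left_distributive f \<and> (\<forall>a c. \<exists>!b. f a b = c)"

definition is_quandle :: "('a \<Rightarrow> 'a \<Rightarrow> 'a) \<Rightarrow> bool" where
  "is_quandle f \<longleftrightarrow> is_rack f \<and> (\<forall>a. f a a = a)"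

definition is_kei :: "('a \<Rightarrow> 'a \<Rightarrow> 'a) \<Rightarrow> bool" where
  "is_kei f \<longleftrightarrow> is_quandle f \<and> (\<forall>a b. f a (f a b) = b)"

text \<open>In \<open>satisfies_Sigma f g\<close> the operation \<open>f\<close> is \<open>*\<close> and \<open>g\<close> is \<open>\<circ>\<close>.\<close>

definition satisfies_Sigma :: "('a \<Rightarrow> 'a \<Rightarrow> 'a) \<Rightarrow> ('a \<Rightarrow> 'a \<Rightarrow> 'a) \<Rightarrow> bool" where
  "satisfies_Sigma f g \<longleftrightarrow>
     (\<forall>a b c. g a (g b c) = g (g a b) c) \<and>
     (\<forall>a b c. f (g a b) c = f a (f b c)) \<and>
     (\<forall>a b c. f a (g b c) = g (f a b) (f a c)) \<and>
     (\<forall>a b. g (f a b) a = g a b)"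

definition binop :: "struct \<Rightarrow> nat \<Rightarrow> nat \<Rightarrow> nat \<Rightarrow> nat" where
  "binop M i a b = op_val M i [a, b]"

definition one_binop_sig :: signature where
  "one_binop_sig = \<lparr>rel_arities = [], op_arities = [2]\<rparr>"

definition two_binop_sig :: signature where
  "two_binop_sig = \<lparr>rel_arities = [], op_arities = [2, 2]\<rparr>"

definition left_distributive_class :: "struct set" where
  "left_distributive_class = {M \<in> structures one_binop_sig. left_distributive (binop M 0)}"

definition rack_class :: "struct set" where
  "rack_class = {M \<in> structures one_binop_sig. is_rack (binop M 0)}"

definition quandle_class :: "struct set" where
  "quandle_class = {M \<in> structures one_binop_sig. is_quandle (binop M 0)}"

definition kei_class :: "struct set" where
  "kei_class = {M \<in> structures one_binop_sig. is_kei (binop M 0)}"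

definition Sigma_class :: "struct set" where
  "Sigma_class = {M \<in> structures two_binop_sig. satisfies_Sigma (binop M 0) (binop M 1)}"

end

theory Submission
  imports Defs
begin

text \<open>
  Every countable structure can be coded, continuously and up to isomorphism, by a countable
  symmetric irreflexive graph without isolated vertices, and such a graph can be recovered both
  from a kei and from an algebra satisfying \<open>\<Sigma>\<close> that are built from it by explicit formulas.

  The graph has a vertex for every number, for every tuple of numbers tagged by a symbol, and for
  every position in such a tuple; the position vertex is joined to the tuple and to the entry
  found there. A structure is then a choice, for every tuple, of one bit, which is the presence or
  absence of a single edge. What makes this rigid is a sequence of label vertices: the label \<open>j\<close>
  has exactly \<open>j + 2\<close> neighbours of degree one, and other vertices have none, so isomorphisms fix
  every label (\<open>graph_iso_code_Lab\<close>). Labels mark the kind of every other vertex, and an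
  isomorphism of graphs therefore comes from a bijection of the numbers that respects all tuples
  (\<open>isomorphic_iff_code\<close>). The vertex set is the same for all structures and each edge depends on
  one coordinate of the structure, so everything built from the graph by inspecting finitely many
  edges is continuous.

  A graph yields a kei by doubling each vertex and letting the two copies of \<open>u\<close> exchange the two
  copies of every neighbour of \<open>u\<close>. Left translations are commuting involutions that do not
  change the vertex of a point, which makes left distributivity trivial. As there are no isolated
  vertices, the pairs of copies are the orbits, and the graph is visible in the quotient
  (\<open>kei_iso_iff_graph_iso\<close>). Keis are quandles, quandles are racks, racks are left distributive,
  so the same reduction serves four classes (\<open>borel_complete_if_contains_keis\<close>).

  For \<open>\<Sigma>\<close>, every commutative semigroup becomes an example when \<open>a * b = b\<close>. A graph yields the
  commutative semigroup in which adjacent vertices have product \<open>Edge\<close>, all other products are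
  \<open>Zero\<close>; threefold products vanish, so it is associative (\<open>Sigma_alg_iso_iff_graph_iso\<close>).
\<close>

section \<open>Structures as relational data\<close>

lemma struct_undefined:
  assumes "M \<in> structures L" "t \<notin> coords L"
  shows "M t = undefined"
  using assms unfolding structures_def cantor_topology_def
  by (auto intro: PiE_arb)

lemma op_val_eq_iff:
  assumes "M \<in> structures L" "i < length (op_arities L)" "length xs = op_arities L ! i"
  shows "op_val M i xs = y \<longleftrightarrow> M (OpSym i, xs @ [y])"
proof -
  have "\<exists>!y. M (OpSym i, xs @ [y])"
    using assms by (simp add: structures_def)
  then show ?thesis
    unfolding op_val_def by (metis theI')
qed

text \<open>An operation is determined by its graph, so it may be treated like a relation. Points of the
  space agree (being undefined) on tuples of the wrong length, and mapping preserves length; hence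
  the right-hand side may range over tuples of all lengths.\<close>

lemma isomorphism_iff:
  assumes M: "M \<in> structures L" and N: "N \<in> structures L"
  shows "isomorphism L h M N \<longleftrightarrow> bij h \<and> (\<forall>s xs. M (s, xs) \<longleftrightarrow> N (s, map h xs))"
proof
  assume h: "isomorphism L h M N"
  then have b: "bij h" by (simp add: isomorphism_def)
  have "M (s, xs) \<longleftrightarrow> N (s, map h xs)" for s xs
  proof (cases "(s, xs) \<in> coords L")
    case False
    then have "(s, map h xs) \<notin> coords L" by (auto simp: coords_def)
    then show ?thesis
      using False struct_undefined[OF M] struct_undefined[OF N] by metis
  next
    case True
    show ?thesis
    proof (cases s)
      case (RelSym i)
      then show ?thesis
        using h True by (auto simp: isomorphism_def rel_holds_def coords_def)
    next
      case (OpSym i)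
      then have i: "i < length (op_arities L)" and l: "length xs = Suc (op_arities L ! i)"
        using True by (auto simp: coords_def)
      obtain ys y where xs: "xs = ys @ [y]"
        using l by (metis length_0_conv nat.simps(3) rev_exhaust)
      have ly: "length ys = op_arities L ! i" using l xs by simp
      have "M (s, xs) \<longleftrightarrow> op_val M i ys = y"
        using op_val_eq_iff[OF M i ly] OpSym xs by simp
      also have "\<dots> \<longleftrightarrow> h (op_val M i ys) = h y"
        using b by (metis bij_def inj_eq)
      also have "\<dots> \<longleftrightarrow> op_val N i (map h ys) = h y"
        using h i ly by (simp add: isomorphism_def)
      also have "\<dots> \<longleftrightarrow> N (s, map h xs)"
        using op_val_eq_iff[OF N i, of "map h ys"] ly OpSym xs by simp
      finally show ?thesis .
    qed
  qed
  then show "bij h \<and> (\<forall>s xs. M (s, xs) \<longleftrightarrow> N (s, map h xs))" using b by blast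
next
  assume h: "bij h \<and> (\<forall>s xs. M (s, xs) \<longleftrightarrow> N (s, map h xs))"
  have "h (op_val M i xs) = op_val N i (map h xs)"
    if i: "i < length (op_arities L)" and l: "length xs = op_arities L ! i" for i xs
  proof -
    have "M (OpSym i, xs @ [op_val M i xs])"
      using op_val_eq_iff[OF M i l] by blast
    then have "N (OpSym i, map h xs @ [h (op_val M i xs)])"
      using h by (metis list.simps(8,9) map_append)
    then show ?thesis
      using op_val_eq_iff[OF N i, of "map h xs"] l by (metis length_map)
  qed
  then show "isomorphism L h M N"
    using h by (simp add: isomorphism_def rel_holds_def)
qed

text \<open>At an index outside the signature all points of the space have the same value, so there the
  set is empty or everything.\<close>

lemma openin_coordinate:
  "openin (cantor_topology L) {M \<in> topspace (cantor_topology L). P (M t)}"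
proof (cases "t \<in> coords L")
  case True
  have "continuous_map (cantor_topology L) (discrete_topology UNIV) (\<lambda>M. M t)"
    unfolding cantor_topology_def using True by (rule continuous_map_product_projection)
  then have "openin (cantor_topology L) {M \<in> topspace (cantor_topology L). M t \<in> {b. P b}}"
    by (rule openin_continuous_map_preimage) simp
  then show ?thesis by simp
next
  case False
  then have undef: "M t = undefined" if "M \<in> topspace (cantor_topology L)" for M
    using that False unfolding cantor_topology_def by (auto intro: PiE_arb)
  have eq: "{M \<in> topspace (cantor_topology L). P (M t)} =
      {M \<in> topspace (cantor_topology L). P undefined}"
    by (intro Collect_cong conj_cong refl) (simp only: undef)
  show ?thesis unfolding eq by (cases "P undefined") simp_all
qed

section \<open>Algebras with binary operations\<close>

definition binop_sig :: "nat \<Rightarrow> signature" where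
  "binop_sig n = \<lparr>rel_arities = [], op_arities = replicate n 2\<rparr>"

definition alg_iso ::
  "nat \<Rightarrow> (nat \<Rightarrow> 'a \<Rightarrow> 'a \<Rightarrow> 'a) \<Rightarrow> (nat \<Rightarrow> 'b \<Rightarrow> 'b \<Rightarrow> 'b) \<Rightarrow> ('a \<Rightarrow> 'b) \<Rightarrow> bool" where
  "alg_iso n A B h \<longleftrightarrow> bij h \<and> (\<forall>i<n. \<forall>a b. h (A i a b) = B i (h a) (h b))"

definition struct_of :: "nat \<Rightarrow> (nat \<Rightarrow> nat \<Rightarrow> nat \<Rightarrow> nat) \<Rightarrow> struct" where
  "struct_of n A =
     (\<lambda>(s, xs)\<in>coords (binop_sig n). case s of
        RelSym i \<Rightarrow> False
      | OpSym i \<Rightarrow> A i (xs ! 0) (xs ! 1) = xs ! 2)"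

lemma coords_binop_sig:
  "coords (binop_sig n) = {(OpSym i, [a, b, c]) | i a b c. i < n}"
proof -
  have "length xs = 3 \<longleftrightarrow> (\<exists>a b c. xs = [a, b, c])" for xs :: "nat list"
    by (auto simp: length_Suc_conv eval_nat_numeral)
  then show ?thesis
    by (auto simp: coords_def binop_sig_def)
qed

lemma struct_of_apply:
  assumes "i < n"
  shows "struct_of n A (OpSym i, [a, b, c]) \<longleftrightarrow> A i a b = c"
  using assms by (simp add: struct_of_def coords_binop_sig)

lemma length_two_iff: "length xs = 2 \<longleftrightarrow> (\<exists>a b. xs = [a, b])"
  by (auto simp: length_Suc_conv eval_nat_numeral)

lemma struct_of_in_structures: "struct_of n A \<in> structures (binop_sig n)"
proof -
  have "struct_of n A \<in> topspace (cantor_topology (binop_sig n))"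
    by (auto simp: cantor_topology_def struct_of_def)
  then show ?thesis
    by (auto simp: structures_def binop_sig_def[of n] length_two_iff struct_of_apply)
qed

lemma binop_struct_of:
  assumes "i < n"
  shows "binop (struct_of n A) i a b = A i a b"
  using assms by (simp add: binop_def op_val_def struct_of_apply)

lemma isomorphism_binop_sig_iff:
  "isomorphism (binop_sig n) h M N \<longleftrightarrow> alg_iso n (binop M) (binop N) h"
  by (auto simp: isomorphism_def alg_iso_def binop_sig_def length_two_iff binop_def)

lemma alg_iso_inv:
  assumes "alg_iso n A B h"
  shows "alg_iso n B A (inv h)"
proof -
  have b: "bij h" using assms by (simp add: alg_iso_def)
  have "inv h (B i a b) = A i (inv h a) (inv h b)" if "i < n" for i a b
  proof -
    have "h (A i (inv h a) (inv h b)) = B i a b"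
      using assms that b by (simp add: alg_iso_def bij_is_surj surj_f_inv_f)
    then show ?thesis
      using b by (metis bij_inv_eq_iff)
  qed
  then show ?thesis
    using b by (simp add: alg_iso_def bij_imp_bij_inv)
qed

lemma alg_iso_comp:
  "alg_iso n A B h \<Longrightarrow> alg_iso n B C k \<Longrightarrow> alg_iso n A C (k \<circ> h)"
  by (auto simp: alg_iso_def bij_comp)

lemma borel_mapI_continuous:
  assumes "continuous_map X Y f"
  shows "borel_map X Y f"
  unfolding borel_map_def
  using assms by (auto simp: continuous_map_def intro!: sigma_sets.Basic)

text \<open>The common frame of both reductions. The target algebras \<open>A M\<close> may live on any countably
  infinite type, and are moved to the natural numbers along one bijection that does not depend
  on \<open>M\<close>. Openness of the sets on which a given product has a given value makes the reduction
  continuous.\<close>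

lemma borel_complete_binop_sigI:
  fixes A :: "struct \<Rightarrow> nat \<Rightarrow> 'a::countable \<Rightarrow> 'a \<Rightarrow> 'a"
  assumes inf: "infinite (UNIV :: 'a set)"
    and fo: "first_order_class (binop_sig n) C"
    and cont: "\<And>L i a b c. i < n \<Longrightarrow>
      openin (cantor_topology L) {M \<in> topspace (cantor_topology L). A M i a b = c}"
    and inC: "\<And>M N e. N \<in> structures (binop_sig n) \<Longrightarrow> alg_iso n (A M) (binop N) e \<Longrightarrow> N \<in> C"
    and iso: "\<And>L M N. M \<in> structures L \<Longrightarrow> N \<in> structures L \<Longrightarrow>
      (\<exists>h. isomorphism L h M N) \<longleftrightarrow> (\<exists>k. alg_iso n (A M) (A N) k)"
  shows "borel_complete (binop_sig n) C"
  unfolding borel_complete_def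
proof (intro conjI allI impI fo)
  fix L C'
  assume fo': "first_order_class L C'"
  then have C': "C' \<subseteq> structures L" by (auto simp: first_order_class_def)
  then have C'top: "C' \<subseteq> topspace (cantor_topology L)" by (auto simp: structures_def)
  define e where "e = to_nat_on (UNIV :: 'a set)"
  have e: "bij e"
    unfolding e_def using inf by (intro to_nat_on_infinite) auto
  define B where "B M i x y = e (A M i (inv e x) (inv e y))" for M i x y
  define f where "f M = struct_of n (B M)" for M
  have eB: "alg_iso n (A M) (binop (f M)) e" for M
    using e by (simp add: alg_iso_def f_def binop_struct_of B_def bij_is_inj)
  have fC: "f M \<in> C" for M
    using inC eB struct_of_in_structures unfolding f_def by blast
  have "continuous_map (cantor_topology L) (cantor_topology (binop_sig n)) f"
    unfolding cantor_topology_def[of "binop_sig n"] continuous_map_componentwise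
  proof (intro conjI ballI)
    show "f ` topspace (cantor_topology L) \<subseteq> extensional (coords (binop_sig n))"
      by (auto simp: f_def struct_of_def)
    fix t
    assume "t \<in> coords (binop_sig n)"
    then obtain i a b c where i: "i < n" and t: "t = (OpSym i, [a, b, c])"
      by (auto simp: coords_binop_sig)
    let ?T = "topspace (cantor_topology L)"
    let ?S = "\<lambda>z. {M \<in> ?T. A M i (inv e a) (inv e b) = z}"
    have ft: "f M t \<longleftrightarrow> A M i (inv e a) (inv e b) = inv e c" for M
      using e i by (auto simp: f_def t struct_of_apply B_def bij_inv_eq_iff)
    \<comment> \<open>Both truth values are taken on open sets: the complement of one cell of the partition
      of the space by the value of the product is the union of the other cells.\<close>
    have "openin (cantor_topology L) {M \<in> ?T. f M t \<in> U}" for U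
    proof -
      have "{M \<in> ?T. f M t \<in> U} = \<Union> (?S ` {z. (z = inv e c) \<in> U})"
        by (auto simp: ft)
      then show ?thesis
        using cont[OF i] by auto
    qed
    then show "continuous_map (cantor_topology L) (discrete_topology UNIV) (\<lambda>M. f M t)"
      by (simp add: continuous_map_def)
  qed
  then have "continuous_map (class_space L C') (class_space (binop_sig n) C) f"
    unfolding class_space_def
    by (intro continuous_map_into_subtopology continuous_map_from_subtopology) (use fC in auto)
  then have "borel_map (class_space L C') (class_space (binop_sig n) C) f"
    by (rule borel_mapI_continuous)
  moreover have "(M, N) \<in> iso_rel L C' \<longleftrightarrow> (f M, f N) \<in> iso_rel (binop_sig n) C"
    if "M \<in> C'" "N \<in> C'" for M N
  proof -
    have "(M, N) \<in> iso_rel L C' \<longleftrightarrow> (\<exists>k. alg_iso n (A M) (A N) k)"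
      using that iso[of M L N] C' by (auto simp: iso_rel_def)
    also have "\<dots> \<longleftrightarrow> (\<exists>h. alg_iso n (binop (f M)) (binop (f N)) h)"
      by (meson eB alg_iso_inv alg_iso_comp)
    also have "\<dots> \<longleftrightarrow> (f M, f N) \<in> iso_rel (binop_sig n) C"
      by (auto simp: iso_rel_def fC isomorphism_binop_sig_iff)
    finally show ?thesis .
  qed
  ultimately show
    "borel_reducible (class_space L C') (iso_rel L C') (class_space (binop_sig n) C)
      (iso_rel (binop_sig n) C)"
    unfolding borel_reducible_def by (intro exI[of _ f]) (auto simp: class_space_def)
qed

section \<open>Coding a structure by a graph\<close>

instance symb :: countable
  by countable_datatype

text \<open>\<open>Pos s xs i\<close> stands for the \<open>i\<close>-th position of the tuple \<open>xs\<close> tagged with the symbol \<open>s\<close>.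
  Indices are unrestricted, even where they make no sense for a given signature or tuple, so that
  the vertices form a type that is independent of the structure.\<close>

datatype vertex =
    Lab nat
  | Leaf nat nat
  | Elem nat
  | Tuple symb "nat list"
  | Pos symb "nat list" nat

instance vertex :: countable
  by countable_datatype

text \<open>The label of a tuple records its symbol and its length; the labels below 4 are reserved for
  other purposes.\<close>

definition kind_label :: "symb \<Rightarrow> nat \<Rightarrow> nat" where
  "kind_label s k = 4 + to_nat (s, k)"

lemma kind_label_simps [simp]:
  "kind_label s k = kind_label s' k' \<longleftrightarrow> s = s' \<and> k = k'"
  "kind_label s k \<noteq> 0" "kind_label s k \<noteq> Suc 0" "kind_label s k \<noteq> 2" "kind_label s k \<noteq> 3"
  "0 \<noteq> kind_label s k" "Suc 0 \<noteq> kind_label s k" "2 \<noteq> kind_label s k" "3 \<noteq> kind_label s k"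
  by (auto simp: kind_label_def)

text \<open>Labels 0 and 1 together mark numbers, label 2 marks tuples, and label 3 marks the tuples that
  belong to the structure: this is the only place where \<open>M\<close> enters. Only the vertices \<open>Leaf j i\<close>
  with \<open>i < j + 2\<close> serve to identify the label \<open>j\<close>. The remaining ones are tied to two labels, so
  that they do not count as leaves, and to a pair of labels that marks nothing else. A position
  beyond the end of its tuple is joined to no number.\<close>

fun arc :: "struct \<Rightarrow> vertex \<Rightarrow> vertex \<Rightarrow> bool" where
  "arc M (Leaf j i) (Lab k) \<longleftrightarrow> (if i < j + 2 then k = j else k = 0 \<or> k = 2)"
| "arc M (Elem x) (Lab k) \<longleftrightarrow> k = 0 \<or> k = 1"
| "arc M (Tuple s xs) (Lab k) \<longleftrightarrow>
     k = 2 \<or> k = kind_label s (length xs) \<or> k = 3 \<and> M (s, xs)"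
| "arc M (Pos s xs i) (Lab k) \<longleftrightarrow> k = i + 4"
| "arc M (Pos s xs i) (Tuple s' ys) \<longleftrightarrow> s' = s \<and> ys = xs"
| "arc M (Pos s xs i) (Elem x) \<longleftrightarrow> i < length xs \<and> x = xs ! i"
| "arc M _ _ \<longleftrightarrow> False"

definition code :: "struct \<Rightarrow> vertex \<Rightarrow> vertex \<Rightarrow> bool" where
  "code M u v \<longleftrightarrow> arc M u v \<or> arc M v u"

definition graph_iso :: "('a \<Rightarrow> 'a \<Rightarrow> bool) \<Rightarrow> ('b \<Rightarrow> 'b \<Rightarrow> bool) \<Rightarrow> ('a \<Rightarrow> 'b) \<Rightarrow> bool" where
  "graph_iso E E' h \<longleftrightarrow> bij h \<and> (\<forall>u v. E u v \<longleftrightarrow> E' (h u) (h v))"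

text \<open>The neighbours of degree one.\<close>

definition leaves :: "('a \<Rightarrow> 'a \<Rightarrow> bool) \<Rightarrow> 'a \<Rightarrow> 'a set" where
  "leaves E v = {u. E v u \<and> (\<exists>!w. E u w)}"

lemma code_sym: "code M u v \<longleftrightarrow> code M v u"
  by (auto simp: code_def)

lemma code_irrefl: "\<not> code M v v"
  by (cases v) (auto simp: code_def)

lemma code_no_isolated: "\<exists>u. code M u v"
proof (cases v)
  case (Lab j)
  then have "code M (Leaf j 0) v" by (simp add: code_def)
  then show ?thesis ..
next
  case (Leaf j i)
  then have "code M (Lab (if i < j + 2 then j else 0)) v" by (simp add: code_def)
  then show ?thesis ..
next
  case (Elem x)
  then have "code M (Lab 0) v" by (simp add: code_def)
  then show ?thesis ..
next
  case (Tuple s xs)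
  then have "code M (Lab 2) v" by (simp add: code_def)
  then show ?thesis ..
next
  case (Pos s xs i)
  then have "code M (Lab (i + 4)) v" by (simp add: code_def)
  then show ?thesis ..
qed

lemma ex1_bij:
  assumes "bij h"
  shows "(\<exists>!w. P (h w)) \<longleftrightarrow> (\<exists>!w. P w)"
proof
  assume "\<exists>!w. P (h w)"
  then obtain w where w: "P (h w)" and uniq: "\<And>v. P (h v) \<Longrightarrow> v = w" by blast
  show "\<exists>!w. P w"
  proof (rule ex1I[of P, OF w])
    fix x
    assume x: "P x"
    obtain v where v: "x = h v" using surjD[OF bij_is_surj[OF assms], of x] by blast
    show "x = h w" using uniq[OF x[unfolded v]] v by simp
  qed
next
  assume "\<exists>!w. P w"
  then obtain x where x: "P x" and uniq: "\<And>y. P y \<Longrightarrow> y = x" by blast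
  obtain w where w: "x = h w" using surjD[OF bij_is_surj[OF assms], of x] by blast
  show "\<exists>!w. P (h w)"
  proof (rule ex1I[of "\<lambda>w. P (h w)", OF x[unfolded w]])
    fix v
    assume "P (h v)"
    then have "h v = h w" using uniq[of "h v"] w by simp
    then show "v = w" using assms by (simp add: bij_is_inj inj_eq)
  qed
qed

lemma leaves_graph_iso:
  assumes "graph_iso E E' h"
  shows "leaves E' (h v) = h ` leaves E v"
proof -
  have b: "bij h" and E: "\<And>u v. E u v \<longleftrightarrow> E' (h u) (h v)"
    using assms by (auto simp: graph_iso_def)
  have "leaves E v = {u. h u \<in> leaves E' (h v)}"
    unfolding leaves_def E by (simp only: ex1_bij[OF b] mem_Collect_eq)
  then have "leaves E v = h -` leaves E' (h v)" by auto
  then show ?thesis using b by (simp add: bij_is_surj surj_image_vimage_eq)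
qed

text \<open>All other vertices were given two neighbours on purpose: \<open>Lab 0\<close> has two leaves rather than
  one for this reason, too.\<close>

lemma code_unique_neighbour_iff:
  "(\<exists>!w. code M u w) \<longleftrightarrow> (\<exists>j i. u = Leaf j i \<and> i < j + 2)"
proof (cases u)
  case (Lab j)
  then have "code M u (Leaf j 0)" "code M u (Leaf j 1)" by (auto simp: code_def)
  then show ?thesis using Lab by (metis vertex.distinct(1) vertex.inject(2) zero_neq_one)
next
  case (Leaf j i)
  show ?thesis
  proof (cases "i < j + 2")
    case True
    have "code M u w \<longleftrightarrow> w = Lab j" for w
      using Leaf True by (cases w) (auto simp: code_def)
    then show ?thesis using Leaf True by auto
  next
    case False
    then have "code M u (Lab 0)" "code M u (Lab 2)" using Leaf by (auto simp: code_def)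
    then show ?thesis using Leaf False
      by (metis vertex.inject(1) vertex.inject(2) zero_neq_numeral)
  qed
next
  case (Elem x)
  then have "code M u (Lab 0)" "code M u (Lab 1)" by (auto simp: code_def)
  then show ?thesis using Elem by (metis vertex.distinct(9) vertex.inject(1) zero_neq_one)
next
  case (Tuple s xs)
  then have "code M u (Lab 2)" "code M u (Lab (kind_label s (length xs)))"
    by (auto simp: code_def)
  then show ?thesis using Tuple
    by (metis kind_label_simps(4) vertex.distinct(11) vertex.inject(1))
next
  case (Pos s xs i)
  then have "code M u (Lab (i + 4))" "code M u (Tuple s xs)" by (auto simp: code_def)
  then show ?thesis using Pos
    by (metis vertex.distinct(5) vertex.distinct(13))
qed

lemma leaves_code_Lab: "leaves (code M) (Lab j) = Leaf j ` {..<j + 2}"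
  unfolding leaves_def code_unique_neighbour_iff by (auto simp: code_def)

lemma leaves_code_not_Lab: "(\<And>j. v \<noteq> Lab j) \<Longrightarrow> leaves (code M) v = {}"
  unfolding leaves_def code_unique_neighbour_iff by (cases v) (auto simp: code_def)

text \<open>The number of leaves at a vertex is invariant under isomorphism and is different for
  different labels.\<close>

lemma graph_iso_code_Lab:
  assumes "graph_iso (code M) (code N) h"
  shows "h (Lab j) = Lab j"
proof -
  have lab: "card (leaves (code K) (Lab i)) = i + 2" for K i
    unfolding leaves_code_Lab by (subst card_image) (auto simp: inj_on_def)
  have "inj h" using assms by (simp add: graph_iso_def bij_is_inj)
  then have c: "card (leaves (code N) (h (Lab j))) = j + 2"
    using lab[of M j]
    by (metis leaves_graph_iso[OF assms] card_image inj_on_subset subset_UNIV)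
  then obtain k where "h (Lab j) = Lab k"
    using leaves_code_not_Lab[of "h (Lab j)" N] by fastforce
  then show ?thesis using c lab[of N k] by simp
qed

text \<open>The next three lemmas describe numbers, tuples and the entries of a tuple by adjacency to
  labels, that is, in terms that every isomorphism of coding graphs preserves.\<close>

lemma code_Elem_iff: "(\<exists>x. v = Elem x) \<longleftrightarrow> code M v (Lab 0) \<and> code M v (Lab 1)"
  by (cases v) (auto simp: code_def)

lemma code_Tuple_iff:
  "(\<exists>xs. v = Tuple s xs \<and> length xs = k) \<longleftrightarrow>
     code M v (Lab 2) \<and> code M v (Lab (kind_label s k))"
  by (cases v) (auto simp: code_def split: if_splits)

lemma code_Pos_iff:
  "(i < length xs \<and> xs ! i = x) \<longleftrightarrow>
     (\<exists>v. code M v (Tuple s xs) \<and> code M v (Elem x) \<and> code M v (Lab (i + 4)))"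
proof
  assume "i < length xs \<and> xs ! i = x"
  then show "\<exists>v. code M v (Tuple s xs) \<and> code M v (Elem x) \<and> code M v (Lab (i + 4))"
    by (intro exI[of _ "Pos s xs i"]) (auto simp: code_def)
next
  assume "\<exists>v. code M v (Tuple s xs) \<and> code M v (Elem x) \<and> code M v (Lab (i + 4))"
  then obtain v where "code M v (Tuple s xs)" "code M v (Elem x)" "code M v (Lab (i + 4))"
    by blast
  then show "i < length xs \<and> xs ! i = x"
    by (cases v) (auto simp: code_def)
qed

fun relabel :: "(nat \<Rightarrow> nat) \<Rightarrow> vertex \<Rightarrow> vertex" where
  "relabel h (Elem x) = Elem (h x)"
| "relabel h (Tuple s xs) = Tuple s (map h xs)"
| "relabel h (Pos s xs i) = Pos s (map h xs) i"
| "relabel h v = v"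

lemma relabel_comp_cancel: "(\<And>x. g (h x) = x) \<Longrightarrow> relabel g (relabel h v) = v"
  by (cases v) (auto simp: map_idI)

lemma graph_iso_relabel:
  assumes h: "bij h" and MN: "\<And>s xs. M (s, xs) \<longleftrightarrow> N (s, map h xs)"
  shows "graph_iso (code M) (code N) (relabel h)"
proof -
  have inj: "inj h" using h by (rule bij_is_inj)
  have "bij (relabel h)"
  proof (rule o_bij)
    show "relabel (inv h) \<circ> relabel h = id"
      by (rule ext) (simp add: relabel_comp_cancel inj)
    show "relabel h \<circ> relabel (inv h) = id"
      by (rule ext) (simp add: relabel_comp_cancel bij_is_surj[OF h] surj_f_inv_f)
  qed
  moreover have "arc M u v \<longleftrightarrow> arc N (relabel h u) (relabel h v)" for u v
    by (cases u; cases v) (auto simp: MN inj_eq[OF inj] inj_map_eq_map[OF inj])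
  ultimately show ?thesis by (simp add: graph_iso_def code_def)
qed

text \<open>The bijection of the numbers is read off from the number vertices. A tuple is sent to a tuple
  with the same symbol and length because of its label, and the position vertices force its
  entries to be the images of the original ones. Adjacency to label 3 then compares the
  structures.\<close>

lemma graph_iso_code_imp:
  assumes p: "graph_iso (code M) (code N) p"
  shows "\<exists>h. bij h \<and> (\<forall>s xs. M (s, xs) \<longleftrightarrow> N (s, map h xs))"
proof -
  have b: "bij p" and E: "\<And>u v. code M u v \<longleftrightarrow> code N (p u) (p v)"
    using p by (auto simp: graph_iso_def)
  have lab: "code M u (Lab j) \<longleftrightarrow> code N (p u) (Lab j)" for u j
    using E graph_iso_code_Lab[OF p] by metis
  have elem: "(\<exists>x. v = Elem x) \<longleftrightarrow> (\<exists>y. p v = Elem y)" for v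
    unfolding code_Elem_iff[of v M] code_Elem_iff[of "p v" N] lab ..
  have "\<forall>x. \<exists>y. p (Elem x) = Elem y" using elem by blast
  from choice[OF this] obtain h where h: "\<And>x. p (Elem x) = Elem (h x)" by blast
  have "bij h"
    unfolding bij_def inj_def surj_def
  proof (intro conjI allI impI)
    fix x y
    assume "h x = h y"
    then have "p (Elem x) = p (Elem y)" by (simp add: h)
    then show "x = y" using b by (simp add: bij_is_inj inj_eq)
  next
    fix y
    obtain v where v: "Elem y = p v" using surjD[OF bij_is_surj[OF b], of "Elem y"] by blast
    have "\<exists>z. p v = Elem z" using v[symmetric] by blast
    then obtain x where "v = Elem x" using elem[of v] by blast
    then have "y = h x" using v h by simp
    then show "\<exists>x. y = h x" by blast
  qed
  moreover have "M (s, xs) \<longleftrightarrow> N (s, map h xs)" for s xs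
  proof -
    obtain ys where ys: "p (Tuple s xs) = Tuple s ys" and l: "length ys = length xs"
      using code_Tuple_iff[of "Tuple s xs" s "length xs" M]
        code_Tuple_iff[of "p (Tuple s xs)" s "length xs" N] lab[of "Tuple s xs"] by auto
    have "ys ! i = h (xs ! i)" if i: "i < length xs" for i
    proof -
      obtain v where "code M v (Tuple s xs)" "code M v (Elem (xs ! i))" "code M v (Lab (i + 4))"
        using iffD1[OF code_Pos_iff conjI[OF i refl]] by blast
      then have "code N (p v) (Tuple s ys)" "code N (p v) (Elem (h (xs ! i)))"
          "code N (p v) (Lab (i + 4))"
        using E[of v "Tuple s xs"] E[of v "Elem (xs ! i)"] lab[of v "i + 4"] ys h by simp_all
      then show ?thesis using code_Pos_iff[of i ys "h (xs ! i)" N s] by blast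
    qed
    then have "ys = map h xs" using l by (simp add: list_eq_iff_nth_eq)
    moreover have "K (s, zs) \<longleftrightarrow> code K (Tuple s zs) (Lab 3)" for K zs
      by (simp add: code_def)
    ultimately show ?thesis using ys lab[of "Tuple s xs" 3] by simp
  qed
  ultimately show ?thesis by blast
qed

lemma isomorphic_iff_code:
  assumes "M \<in> structures L" "N \<in> structures L"
  shows "(\<exists>h. isomorphism L h M N) \<longleftrightarrow> (\<exists>p. graph_iso (code M) (code N) p)"
proof
  assume "\<exists>h. isomorphism L h M N"
  then obtain h where "bij h" "\<forall>s xs. M (s, xs) \<longleftrightarrow> N (s, map h xs)"
    unfolding isomorphism_iff[OF assms] by blast
  then have "graph_iso (code M) (code N) (relabel h)"
    by (intro graph_iso_relabel) simp_all
  then show "\<exists>p. graph_iso (code M) (code N) p" by blast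
next
  assume "\<exists>p. graph_iso (code M) (code N) p"
  then show "\<exists>h. isomorphism L h M N"
    unfolding isomorphism_iff[OF assms] using graph_iso_code_imp[of M N] by blast
qed

text \<open>This is what makes every algebra built from the graph depend continuously on the structure.\<close>

lemma code_depends_on_one_coordinate: "\<exists>t P. \<forall>M. code M u v \<longleftrightarrow> P (M t)"
proof -
  have *: "\<exists>t P. \<forall>M. arc M u v \<longleftrightarrow> P (M t)" for u v
  proof (cases "\<exists>s xs. u = Tuple s xs \<and> v = Lab 3")
    case True
    then obtain s xs where "u = Tuple s xs" "v = Lab 3" by blast
    then show ?thesis by (intro exI[of _ "(s, xs)"] exI[of _ "\<lambda>b. b"]) simp
  next
    case False
    then have "arc M u v \<longleftrightarrow> arc (\<lambda>_. False) u v" for M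
      by (cases u; cases v) auto
    then show ?thesis by (intro exI[of _ undefined] exI[of _ "\<lambda>_. arc (\<lambda>_. False) u v"]) simp
  qed
  show ?thesis
  proof (cases "\<forall>M. \<not> arc M v u")
    case True
    then show ?thesis using *[of u v] by (simp add: code_def)
  next
    case False
    then have "\<forall>M. \<not> arc M u v"
      by (cases u; cases v) auto
    then show ?thesis using *[of v u] by (simp add: code_def)
  qed
qed

lemma openin_code:
  "openin (cantor_topology L) {M \<in> topspace (cantor_topology L). Q (code M u v)}"
proof -
  obtain t P where "\<forall>M. code M u v \<longleftrightarrow> P (M t)"
    using code_depends_on_one_coordinate by blast
  then show ?thesis using openin_coordinate[of L "\<lambda>b. Q (P b)" t] by simp
qed

lemma infinite_vertex: "infinite (UNIV :: vertex set)"
proof -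
  have "inj Lab" by (auto simp: inj_def)
  then show ?thesis by (metis infinite_UNIV_nat finite_imageD finite_subset subset_UNIV)
qed

section \<open>A kei from a graph\<close>

text \<open>The first factor acts through its vertex only, by the involution that exchanges the two copies
  of each of its neighbours.\<close>

definition kei_op :: "('v \<Rightarrow> 'v \<Rightarrow> bool) \<Rightarrow> 'v \<times> bool \<Rightarrow> 'v \<times> bool \<Rightarrow> 'v \<times> bool" where
  "kei_op E a b = (fst b, snd b \<noteq> E (fst a) (fst b))"

text \<open>Left distributivity holds because a product lies over the same vertex as its right factor, so
  that both act in the same way, and because the exchanges commute. Irreflexivity gives
  idempotence.\<close>

lemma is_kei_kei_op:
  assumes "\<And>v. \<not> E v v"
  shows "is_kei (kei_op E)"
proof -
  have invol: "kei_op E a (kei_op E a b) = b" for a b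
    by (auto simp: kei_op_def prod_eq_iff)
  then have "\<exists>!b. kei_op E a b = c" for a c
    by metis
  moreover have "left_distributive (kei_op E)"
    by (auto simp: left_distributive_def kei_op_def)
  moreover have "kei_op E a a = a" for a
    using assms by (simp add: kei_op_def prod_eq_iff)
  ultimately show ?thesis
    using invol by (simp add: is_kei_def is_quandle_def is_rack_def)
qed

text \<open>Since every vertex has a neighbour, its two copies are exchanged by some left translation, and
  an isomorphism of keis must send them to the two copies of one vertex. So it induces a bijection
  of the vertices; adjacency means acting non-trivially.\<close>

lemma kei_iso_iff_graph_iso:
  fixes E :: "'v \<Rightarrow> 'v \<Rightarrow> bool" and E' :: "'w \<Rightarrow> 'w \<Rightarrow> bool"
  assumes src: "\<And>v. \<exists>u. E u v"
  shows "(\<exists>k. alg_iso 1 (\<lambda>_. kei_op E) (\<lambda>_. kei_op E') k) \<longleftrightarrow> (\<exists>h. graph_iso E E' h)"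
proof
  assume "\<exists>h. graph_iso E E' h"
  then obtain h where h: "bij h" "\<And>u v. E u v \<longleftrightarrow> E' (h u) (h v)"
    by (auto simp: graph_iso_def)
  have "bij (map_prod h id :: 'v \<times> bool \<Rightarrow> 'w \<times> bool)"
    using h(1) by (intro bij_betw_map_prod[of _ UNIV UNIV _ UNIV UNIV, simplified]) auto
  then have "alg_iso 1 (\<lambda>_. kei_op E) (\<lambda>_. kei_op E') (map_prod h id)"
    by (simp add: alg_iso_def kei_op_def prod_eq_iff h(2))
  then show "\<exists>k. alg_iso 1 (\<lambda>_. kei_op E) (\<lambda>_. kei_op E') k" by blast
next
  assume "\<exists>k. alg_iso 1 (\<lambda>_. kei_op E) (\<lambda>_. kei_op E') k"
  then obtain k where b: "bij k" and k: "\<And>a b. k (kei_op E a b) = kei_op E' (k a) (k b)"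
    by (auto simp: alg_iso_def)
  define h where "h v = fst (k (v, False))" for v
  have fst_k: "fst (k (v, i)) = h v" for v i
  proof (cases i)
    case True
    obtain u where "E u v" using src by blast
    then have "kei_op E (u, False) (v, False) = (v, True)" by (simp add: kei_op_def)
    then have "k (v, True) = kei_op E' (k (u, False)) (k (v, False))" using k by metis
    then show ?thesis using True by (simp add: kei_op_def h_def)
  qed (simp add: h_def)
  have k_eq: "k a = k b \<longleftrightarrow> a = b" for a b
    using b by (metis bij_def inj_eq)
  have "inj h"
  proof (rule injI)
    fix v w
    assume "h v = h w"
    \<comment> \<open>The fibre over a vertex has only two points, and two come from \<open>v\<close> already.\<close>
    then have "k (w, False) = k (v, False) \<or> k (w, False) = k (v, True)"
      using fst_k k_eq[of "(v, False)" "(v, True)"] by (auto simp: prod_eq_iff)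
    then show "v = w" by (auto simp: k_eq)
  qed
  moreover have "surj h"
    unfolding surj_def
  proof
    fix w
    obtain a where "(w, False) = k a" using surjD[OF bij_is_surj[OF b]] by blast
    then show "\<exists>v. w = h v" using fst_k[of "fst a" "snd a"] by (metis fst_conv prod.collapse)
  qed
  moreover have "E u v \<longleftrightarrow> E' (h u) (h v)" for u v
  proof -
    have "\<not> E u v \<longleftrightarrow> kei_op E (u, False) (v, False) = (v, False)"
      by (simp add: kei_op_def)
    also have "\<dots> \<longleftrightarrow> kei_op E' (k (u, False)) (k (v, False)) = k (v, False)"
      using k k_eq by metis
    also have "\<dots> \<longleftrightarrow> \<not> E' (h u) (h v)"
      by (auto simp: kei_op_def prod_eq_iff h_def)
    finally show ?thesis by blast
  qed
  ultimately show "\<exists>h. graph_iso E E' h" by (auto simp: graph_iso_def bij_def)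
qed

lemma is_kei_alg_iso:
  assumes "alg_iso (Suc 0) A B e" "is_kei (A 0)"
  shows "is_kei (B 0)"
proof -
  have b: "bij e" and e: "\<And>a b. B 0 (e a) (e b) = e (A 0 a b)"
    using assms(1) by (auto simp: alg_iso_def)
  have B: "B 0 x y = e (A 0 (inv e x) (inv e y))" for x y
    using b e by (metis bij_inv_eq_iff)
  have e_inv: "e (inv e x) = x" "inv e (e y) = y" for x y
    using b by (metis bij_inv_eq_iff)+
  have "\<exists>!y. B 0 a y = c" for a c
  proof -
    have "\<exists>!y. A 0 (inv e a) y = inv e c"
      using assms(2) by (simp add: is_kei_def is_quandle_def is_rack_def)
    then show ?thesis
      unfolding B using e_inv by metis
  qed
  then show ?thesis
    using assms(2)
    by (simp add: is_kei_def is_quandle_def is_rack_def left_distributive_def B e_inv)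
qed

section \<open>A commutative semigroup from a graph\<close>

text \<open>Products of two vertices are \<open>Edge\<close> or \<open>Zero\<close>, and products of three elements are \<open>Zero\<close>: the
  semigroup is nilpotent of class 3.\<close>

datatype 'v nil3 = Vert 'v | Edge | Zero

instance nil3 :: (countable) countable
  by countable_datatype

fun nil3_op :: "('v \<Rightarrow> 'v \<Rightarrow> bool) \<Rightarrow> 'v nil3 \<Rightarrow> 'v nil3 \<Rightarrow> 'v nil3" where
  "nil3_op E (Vert u) (Vert v) = (if E u v then Edge else Zero)"
| "nil3_op E _ _ = Zero"

definition Sigma_alg :: "('v \<Rightarrow> 'v \<Rightarrow> bool) \<Rightarrow> nat \<Rightarrow> 'v nil3 \<Rightarrow> 'v nil3 \<Rightarrow> 'v nil3" where
  "Sigma_alg E i = (if i = 0 then (\<lambda>a b. b) else nil3_op E)"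

lemma nil3_op_cases: "nil3_op E a b = Edge \<or> nil3_op E a b = Zero"
  by (cases "(E, a, b)" rule: nil3_op.cases) auto

lemma nil3_op_Zero [simp]: "nil3_op E a Zero = Zero" "nil3_op E a Edge = Zero"
  by (cases a; simp)+

text \<open>If \<open>*\<close> is the right projection, then the identities of \<open>\<Sigma>\<close> reduce to associativity and
  commutativity of \<open>\<circ>\<close>.\<close>

lemma satisfies_Sigma_alg:
  assumes sym: "\<And>u v. E u v \<longleftrightarrow> E v u"
  shows "satisfies_Sigma (Sigma_alg E 0) (Sigma_alg E 1)"
proof -
  have assoc: "nil3_op E a (nil3_op E b c) = nil3_op E (nil3_op E a b) c" for a b c
    using nil3_op_cases[of E b c] nil3_op_cases[of E a b] by auto
  have comm: "nil3_op E b a = nil3_op E a b" for a b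
    by (cases a; cases b) (auto simp: sym)
  show ?thesis
    unfolding satisfies_Sigma_def Sigma_alg_def
    by (intro conjI allI; simp; rule assoc comm)
qed

text \<open>\<open>Zero\<close> is the absorbing element and, as soon as there is an edge, \<open>Edge\<close> is the only other
  product. So isomorphisms fix both and permute the vertices.\<close>

lemma Sigma_alg_iso_iff_graph_iso:
  fixes E :: "'v \<Rightarrow> 'v \<Rightarrow> bool" and E' :: "'w \<Rightarrow> 'w \<Rightarrow> bool"
  assumes edge: "E u0 v0"
  shows "(\<exists>k. alg_iso 2 (Sigma_alg E) (Sigma_alg E') k) \<longleftrightarrow> (\<exists>h. graph_iso E E' h)"
proof
  assume "\<exists>h. graph_iso E E' h"
  then obtain h where h: "bij h" "\<And>u v. E u v \<longleftrightarrow> E' (h u) (h v)"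
    by (auto simp: graph_iso_def)
  have "bij (map_nil3 h)"
  proof (rule o_bij)
    show "map_nil3 (inv h) \<circ> map_nil3 h = id"
      using h(1) by (simp add: nil3.map_comp[symmetric] fun_eq_iff nil3.map_comp
          bij_is_inj nil3.map_id o_def nil3.map_ident)
    show "map_nil3 h \<circ> map_nil3 (inv h) = id"
      using h(1) by (simp add: fun_eq_iff nil3.map_comp bij_is_surj surj_f_inv_f
          o_def nil3.map_ident)
  qed
  moreover have "map_nil3 h (nil3_op E a b) = nil3_op E' (map_nil3 h a) (map_nil3 h b)" for a b
    by (cases a; cases b) (auto simp: h(2))
  ultimately have "alg_iso 2 (Sigma_alg E) (Sigma_alg E') (map_nil3 h)"
    by (simp add: alg_iso_def Sigma_alg_def)
  then show "\<exists>k. alg_iso 2 (Sigma_alg E) (Sigma_alg E') k" by blast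
next
  assume "\<exists>k. alg_iso 2 (Sigma_alg E) (Sigma_alg E') k"
  then obtain k where b: "bij k" and al: "alg_iso 2 (Sigma_alg E) (Sigma_alg E') k"
    by (auto simp: alg_iso_def)
  have k: "k (nil3_op E a b) = nil3_op E' (k a) (k b)" for a b
  proof -
    have "k (Sigma_alg E 1 a b) = Sigma_alg E' 1 (k a) (k b)"
      using al by (simp add: alg_iso_def)
    then show ?thesis by (simp add: Sigma_alg_def)
  qed
  have k_eq: "k a = k b \<longleftrightarrow> a = b" for a b
    using b by (metis bij_def inj_eq)
  obtain z where z: "k z = Zero" using surjD[OF bij_is_surj[OF b], of Zero] by metis
  have "k Zero = nil3_op E' (k Zero) (k z)"
    using k[of Zero z] by simp
  then have k_Zero: "k Zero = Zero" using z by simp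
  have "k Edge = nil3_op E' (k (Vert u0)) (k (Vert v0))"
    using k[of "Vert u0" "Vert v0"] edge by simp
  then have k_Edge: "k Edge = Edge"
    using nil3_op_cases k_Zero k_eq by (metis nil3.distinct(5))
  have "\<forall>v. \<exists>w. k (Vert v) = Vert w"
  proof
    fix v
    have "k (Vert v) \<noteq> Zero" "k (Vert v) \<noteq> Edge"
      using k_eq[of "Vert v" Zero] k_eq[of "Vert v" Edge] k_Zero k_Edge by auto
    then show "\<exists>w. k (Vert v) = Vert w" by (cases "k (Vert v)") auto
  qed
  from choice[OF this] obtain h where h: "\<And>v. k (Vert v) = Vert (h v)" by blast
  have "inj h"
  proof (rule injI)
    fix v w
    assume "h v = h w"
    then have "k (Vert v) = k (Vert w)" by (simp add: h)
    then show "v = w" by (simp add: k_eq)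
  qed
  moreover have "surj h"
    unfolding surj_def
  proof
    fix w
    obtain a where a: "k a = Vert w" using surjD[OF bij_is_surj[OF b], of "Vert w"] by metis
    then obtain v where "a = Vert v" using k_Zero k_Edge by (cases a) auto
    then show "\<exists>v. w = h v" using a h by auto
  qed
  moreover have "E u v \<longleftrightarrow> E' (h u) (h v)" for u v
    using k[of "Vert u" "Vert v"] k_Zero k_Edge by (auto simp: h split: if_splits)
  ultimately show "\<exists>h. graph_iso E E' h" by (auto simp: graph_iso_def bij_def)
qed

lemma satisfies_Sigma_alg_iso:
  assumes "alg_iso 2 A B e" "satisfies_Sigma (A 0) (A 1)"
  shows "satisfies_Sigma (B 0) (B 1)"
proof -
  have b: "bij e" and e: "\<And>i a b. i < 2 \<Longrightarrow> B i (e a) (e b) = e (A i a b)"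
    using assms(1) by (auto simp: alg_iso_def)
  have e_inv: "e (inv e x) = x" "inv e (e y) = y" for x y
    using b by (metis bij_inv_eq_iff)+
  have B: "B i x y = e (A i (inv e x) (inv e y))" if "i < 2" for i x y
    using e[OF that, of "inv e x" "inv e y"] by (simp add: e_inv)
  have B01: "B 0 x y = e (A 0 (inv e x) (inv e y))"
      "B (Suc 0) x y = e (A (Suc 0) (inv e x) (inv e y))" for x y
    using B[of 0] B[of 1] by auto
  show ?thesis
    using assms(2) by (simp add: satisfies_Sigma_def B01 e_inv)
qed

section \<open>The five classes are first-order\<close>

lemma first_order_classI:
  assumes "\<And>p. p \<in> T \<Longrightarrow> sentence L p"
    and "\<And>M. M \<in> structures L \<Longrightarrow> P M \<longleftrightarrow> (\<forall>p\<in>T. \<forall>v. sat M v p)"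
  shows "first_order_class L {M \<in> structures L. P M}"
  unfolding first_order_class_def using assms by (intro exI[of _ T]) auto

abbreviation prod_tm :: "nat \<Rightarrow> tm \<Rightarrow> tm \<Rightarrow> tm" where
  "prod_tm i s t \<equiv> App i [s, t]"

abbreviation all3 :: "fm \<Rightarrow> fm" where
  "all3 p \<equiv> Forall 0 (Forall 1 (Forall 2 p))"

abbreviation star_tm :: "tm \<Rightarrow> tm \<Rightarrow> tm" where
  "star_tm \<equiv> prod_tm 0"

abbreviation circ_tm :: "tm \<Rightarrow> tm \<Rightarrow> tm" where
  "circ_tm \<equiv> prod_tm 1"

definition distributive_axiom :: fm where
  "distributive_axiom = all3 (Eq (star_tm (Var 0) (star_tm (Var 1) (Var 2)))
     (star_tm (star_tm (Var 0) (Var 1)) (star_tm (Var 0) (Var 2))))"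

text \<open>Unique solvability of \<open>a * b = c\<close> is split into uniqueness and existence.\<close>

definition injective_axiom :: fm where
  "injective_axiom = all3 (Neg (Conj (Eq (star_tm (Var 0) (Var 1)) (star_tm (Var 0) (Var 2)))
     (Neg (Eq (Var 1) (Var 2)))))"

definition surjective_axiom :: fm where
  "surjective_axiom =
     Forall 0 (Forall 2 (Neg (Forall 1 (Neg (Eq (star_tm (Var 0) (Var 1)) (Var 2))))))"

definition idempotent_axiom :: fm where
  "idempotent_axiom = Forall 0 (Eq (star_tm (Var 0) (Var 0)) (Var 0))"

definition involutive_axiom :: fm where
  "involutive_axiom = Forall 0 (Forall 1 (Eq (star_tm (Var 0) (star_tm (Var 0) (Var 1))) (Var 1)))"

lemmas axiom_defs = distributive_axiom_def injective_axiom_def surjective_axiom_def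
  idempotent_axiom_def involutive_axiom_def

lemma axioms_sentences:
  "p \<in> {distributive_axiom, injective_axiom, surjective_axiom, idempotent_axiom,
     involutive_axiom} \<Longrightarrow> sentence one_binop_sig p"
  by (auto simp: axiom_defs sentence_def one_binop_sig_def)

lemma sat_axioms:
  "sat M v distributive_axiom \<longleftrightarrow> left_distributive (binop M 0)"
  "sat M v injective_axiom \<longleftrightarrow> (\<forall>a b b'. binop M 0 a b = binop M 0 a b' \<longrightarrow> b = b')"
  "sat M v surjective_axiom \<longleftrightarrow> (\<forall>a c. \<exists>b. binop M 0 a b = c)"
  "sat M v idempotent_axiom \<longleftrightarrow> (\<forall>a. binop M 0 a a = a)"
  "sat M v involutive_axiom \<longleftrightarrow> (\<forall>a b. binop M 0 a (binop M 0 a b) = b)"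
  by (simp_all add: axiom_defs left_distributive_def binop_def)

lemma is_rack_iff_axioms:
  "is_rack (binop M 0) \<longleftrightarrow>
     (\<forall>p\<in>{distributive_axiom, injective_axiom, surjective_axiom}. \<forall>v. sat M v p)"
proof -
  have "(\<forall>a c. \<exists>!b. binop M 0 a b = c) \<longleftrightarrow>
      (\<forall>a b b'. binop M 0 a b = binop M 0 a b' \<longrightarrow> b = b') \<and> (\<forall>a c. \<exists>b. binop M 0 a b = c)"
    by metis
  then show ?thesis by (simp add: is_rack_def sat_axioms)
qed

lemma first_order_left_distributive: "first_order_class one_binop_sig left_distributive_class"
  unfolding left_distributive_class_def
  by (rule first_order_classI[where T = "{distributive_axiom}"])
    (use axioms_sentences in \<open>auto simp: sat_axioms\<close>)

lemma first_order_rack: "first_order_class one_binop_sig rack_class"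
  unfolding rack_class_def
  by (rule first_order_classI[OF _ is_rack_iff_axioms]) (use axioms_sentences in auto)

lemma first_order_quandle: "first_order_class one_binop_sig quandle_class"
  unfolding quandle_class_def
proof (rule first_order_classI)
  show "is_quandle (binop M 0) \<longleftrightarrow>
      (\<forall>p\<in>{distributive_axiom, injective_axiom, surjective_axiom, idempotent_axiom}.
        \<forall>v. sat M v p)" for M
    by (simp add: is_quandle_def is_rack_iff_axioms sat_axioms)
qed (use axioms_sentences in auto)

lemma first_order_kei: "first_order_class one_binop_sig kei_class"
  unfolding kei_class_def
proof (rule first_order_classI)
  show "is_kei (binop M 0) \<longleftrightarrow>
      (\<forall>p\<in>{distributive_axiom, injective_axiom, surjective_axiom, idempotent_axiom,
         involutive_axiom}. \<forall>v. sat M v p)" for M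
    by (simp add: is_kei_def is_quandle_def is_rack_iff_axioms sat_axioms)
qed (use axioms_sentences in auto)

lemma first_order_Sigma: "first_order_class two_binop_sig Sigma_class"
  unfolding Sigma_class_def
proof (rule first_order_classI)
  let ?x = "Var 0" and ?y = "Var 1" and ?z = "Var 2"
  let ?T = "{all3 (Eq (circ_tm ?x (circ_tm ?y ?z)) (circ_tm (circ_tm ?x ?y) ?z)),
    all3 (Eq (star_tm (circ_tm ?x ?y) ?z) (star_tm ?x (star_tm ?y ?z))),
    all3 (Eq (star_tm ?x (circ_tm ?y ?z)) (circ_tm (star_tm ?x ?y) (star_tm ?x ?z))),
    Forall 0 (Forall 1 (Eq (circ_tm (star_tm ?x ?y) ?x) (circ_tm ?x ?y)))}"
  show "sentence two_binop_sig p" if "p \<in> ?T" for p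
    using that by (auto simp: sentence_def two_binop_sig_def)
  show "satisfies_Sigma (binop M 0) (binop M 1) \<longleftrightarrow> (\<forall>p\<in>?T. \<forall>v. sat M v p)" for M
    by (simp add: satisfies_Sigma_def binop_def)
qed

section \<open>Borel completeness\<close>

lemma one_binop_sig_eq: "one_binop_sig = binop_sig 1"
  by (simp add: one_binop_sig_def binop_sig_def)

lemma two_binop_sig_eq: "two_binop_sig = binop_sig 2"
  by (simp add: two_binop_sig_def binop_sig_def numeral_2_eq_2)

lemma borel_complete_if_contains_keis:
  assumes fo: "first_order_class one_binop_sig C" and sub: "kei_class \<subseteq> C"
  shows "borel_complete one_binop_sig C"
  unfolding one_binop_sig_eq
proof (rule borel_complete_binop_sigI[where A = "\<lambda>M _. kei_op (code M)"])
  show "infinite (UNIV :: (vertex \<times> bool) set)"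
    using infinite_vertex by (simp add: finite_prod)
  show "first_order_class (binop_sig 1) C"
    using fo by (simp add: one_binop_sig_eq)
  show "openin (cantor_topology L)
      {M \<in> topspace (cantor_topology L). kei_op (code M) a b = c}" for L a b c
    using openin_code[of L "\<lambda>e. (fst b, snd b \<noteq> e) = c" "fst a" "fst b"]
    by (simp add: kei_op_def)
  show "N \<in> C"
    if "N \<in> structures (binop_sig 1)" "alg_iso 1 (\<lambda>_. kei_op (code M)) (binop N) e" for M N e
  proof -
    have "is_kei (kei_op (code M))" by (rule is_kei_kei_op) (rule code_irrefl)
    then have "is_kei (binop N 0)" using is_kei_alg_iso[OF that(2)[simplified]] by simp
    then show ?thesis using that(1) sub by (auto simp: kei_class_def one_binop_sig_eq)
  qed
  show "(\<exists>h. isomorphism L h M N) \<longleftrightarrow>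
      (\<exists>k. alg_iso 1 (\<lambda>_. kei_op (code M)) (\<lambda>_. kei_op (code N)) k)"
    if "M \<in> structures L" "N \<in> structures L" for L M N
    using isomorphic_iff_code[OF that] kei_iso_iff_graph_iso[of "code M" "code N"] code_no_isolated[of M] by simp
qed

lemma borel_complete_Sigma: "borel_complete two_binop_sig Sigma_class"
  unfolding two_binop_sig_eq
proof (rule borel_complete_binop_sigI[where A = "\<lambda>M. Sigma_alg (code M)"])
  have "inj (Vert :: vertex \<Rightarrow> vertex nil3)" by (auto simp: inj_def)
  then show "infinite (UNIV :: vertex nil3 set)"
    using infinite_vertex by (metis finite_imageD finite_subset subset_UNIV)
  show "first_order_class (binop_sig 2) Sigma_class"
    using first_order_Sigma by (simp add: two_binop_sig_eq)
  show "openin (cantor_topology L)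
      {M \<in> topspace (cantor_topology L). Sigma_alg (code M) i a b = c}" for L i a b c
  proof -
    obtain u v Q where "\<forall>E. Sigma_alg E i a b = c \<longleftrightarrow> Q (E u v)"
    proof (cases "i \<noteq> 0 \<and> (\<exists>u v. a = Vert u \<and> b = Vert v)")
      case True
      then obtain u v where "i \<noteq> 0" "a = Vert u" "b = Vert v" by blast
      then have "\<forall>E. Sigma_alg E i a b = c \<longleftrightarrow> (\<lambda>e. (if e then Edge else Zero) = c) (E u v)"
        by (simp add: Sigma_alg_def)
      then show ?thesis by (rule that)
    next
      case False
      then have "\<forall>E. Sigma_alg E i a b = c \<longleftrightarrow>
          (\<lambda>_. Sigma_alg (\<lambda>_ _. False) i a b = c) (E undefined undefined)"
        by (cases a; cases b) (auto simp: Sigma_alg_def)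
      then show ?thesis by (rule that)
    qed
    then show ?thesis using openin_code[of L Q u v] by simp
  qed
  show "N \<in> Sigma_class"
    if "N \<in> structures (binop_sig 2)" "alg_iso 2 (Sigma_alg (code M)) (binop N) e" for M N e
  proof -
    have "satisfies_Sigma (Sigma_alg (code M) 0) (Sigma_alg (code M) 1)"
      by (rule satisfies_Sigma_alg) (rule code_sym)
    then show ?thesis
      using that satisfies_Sigma_alg_iso by (simp add: Sigma_class_def two_binop_sig_eq)
  qed
  show "(\<exists>h. isomorphism L h M N) \<longleftrightarrow>
      (\<exists>k. alg_iso 2 (Sigma_alg (code M)) (Sigma_alg (code N)) k)"
    if "M \<in> structures L" "N \<in> structures L" for L M N
  proof -
    obtain u where "code M u (Lab 0)" using code_no_isolated by blast
    then show ?thesis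
      using isomorphic_iff_code[OF that] Sigma_alg_iso_iff_graph_iso[of "code M" u "Lab 0" "code N"]
      by simp
  qed
qed

theorem theorem4:
  "borel_complete one_binop_sig kei_class \<and>
   borel_complete one_binop_sig quandle_class \<and>
   borel_complete one_binop_sig rack_class \<and>
   borel_complete one_binop_sig left_distributive_class \<and>
   borel_complete two_binop_sig Sigma_class"
proof -
  have "kei_class \<subseteq> quandle_class" "kei_class \<subseteq> rack_class"
      "kei_class \<subseteq> left_distributive_class"
    by (auto simp: kei_class_def quandle_class_def rack_class_def left_distributive_class_def
        is_kei_def is_quandle_def is_rack_def)
  then show ?thesis
    using borel_complete_if_contains_keis first_order_kei first_order_quandle first_order_rack
      first_order_left_distributive borel_complete_Sigma by blast
qed

end
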